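(* Let $d>1$ and $m\ge 1$ be integers. Let $F=(F_1,\dots,F_m)^\top:(0,1)^d\to\mathbb{R}^m$, let $f$ be a real-valued function on $\mathbb{R}^m$, and let $\Gamma_1,\Gamma_2$ be functions on $(0,1)^{d-1}$ with $0\le\Gamma_1(\bm v)\le\Gamma_2(\bm v)\le 1$ for all $\bm v\in(0,1)^{d-1}$. Suppose that $\Gamma_1$, $\Gamma_2$, the components $F_i$, and $f$ are continuous functions. For $\bm u=(u_1,\dots,u_d)^\top\in(0,1)^d$ write $\bm u_{2:d}=(u_2,\dots,u_d)^\top$ and define $$h(\bm u)=f(F(\bm u))\,\mathbb{I}\{\Gamma_1(\bm u_{2:d})<u_1<\Gamma_2(\bm u_{2:d})\},$$ $$\tilde h(\bm u)=\bigl(\Gamma_2(\bm u_{2:d})-\Gamma_1(\bm u_{2:d})\bigr)\,f(F(\tilde{\bm u})),\qquad \tilde{\bm u}=\bigl(\Gamma_1(\bm u_{2:d})+(\Gamma_2(\bm u_{2:d})-\Gamma_1(\bm u_{2:d}))u_1,\ \bm u_{2:d}\bigr)^\top .$$ Let $\bm u$ be uniformly distributed on $(0,1)^d$. Then $\tilde h(\bm u)$ has the following properties: (1) (Continuity) $\tilde h(\bm u)$ is a continuous function for $\bm u\in(0,1)^d$. (2) (Unbiasedness) $\mathbb{E}[\tilde h(\bm u)]=\mathbb{E}[h(\bm u)]$. (3) (Variance reduction) $\mathrm{Var}(\tilde h(\bm u))\le c\,\mathrm{Var}(h(\bm u))$, where $c=\sup_{\bm v\in(0,1)^{d-1}}\bigl(\Gamma_2(\bm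 v)-\Gamma_1(\bm v)\bigr)$.
   Context: $\mathbb{I}\{\cdot\}$ denotes the indicator function, $\mathbb{E}$ the expectation and $\mathrm{Var}$ the variance. The setting is the estimation of the expectation $\mu=\mathbb{E}[h(\bm u)]$ by Monte Carlo or quasi-Monte Carlo sampling, where $h$ is a discontinuous integrand and $\tilde h$ is its smoothed version, obtained from the change of variable $u_1\mapsto \Gamma_1(\bm u_{2:d})+(\Gamma_2(\bm u_{2:d})-\Gamma_1(\bm u_{2:d}))u_1$ for fixed $\bm u_{2:d}$.
   Formalization: Continuity (1) is proved only at points u where ũ lies in (0,1)^d; where Γ1=Γ2=0 or Γ1=Γ2=1, F(ũ) is undefined, and with h̃=0 there continuity can fail (Γ1=0, Γ2(v)=|v−1/2|, f(F(u))=1/u1²). *)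

theory Defs
  imports "HOL-Probability.Probability"
begin

text \<open>
  Points of \<open>(0,1)^d\<close>, \<open>d > 1\<close>, are pairs \<open>(u\<^sub>1, u\<^sub>2\<^sub>:\<^sub>d) :: real \<times> (real ^ 'n)\<close>, so that
  \<open>d = 1 + CARD('n) > 1\<close>.
\<close>

definition open_cube :: "(real ^ 'n) set" where
  "open_cube = {v. \<forall>i. 0 < v $ i \<and> v $ i < 1}"

definition unit_cube :: "(real \<times> (real ^ 'n)) set" where
  "unit_cube = {0<..<1} \<times> open_cube"

definition tilde_pt ::
  "(real ^ 'n \<Rightarrow> real) \<Rightarrow> (real ^ 'n \<Rightarrow> real) \<Rightarrow> real \<times> (real ^ 'n) \<Rightarrow> real \<times> (real ^ 'n)" where
  "tilde_pt \<Gamma>1 \<Gamma>2 u =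
     (\<Gamma>1 (snd u) + (\<Gamma>2 (snd u) - \<Gamma>1 (snd u)) * fst u, snd u)"

definition h_disc ::
  "(real ^ 'm \<Rightarrow> real) \<Rightarrow> (real \<times> (real ^ 'n) \<Rightarrow> real ^ 'm) \<Rightarrow>
   (real ^ 'n \<Rightarrow> real) \<Rightarrow> (real ^ 'n \<Rightarrow> real) \<Rightarrow> real \<times> (real ^ 'n) \<Rightarrow> real" where
  "h_disc f F \<Gamma>1 \<Gamma>2 u = f (F u) * indicator {u. \<Gamma>1 (snd u) < fst u \<and> fst u < \<Gamma>2 (snd u)} u"

definition h_smooth ::
  "(real ^ 'm \<Rightarrow> real) \<Rightarrow> (real \<times> (real ^ 'n) \<Rightarrow> real ^ 'm) \<Rightarrow>
   (real ^ 'n \<Rightarrow> real) \<Rightarrow> (real ^ 'n \<Rightarrow> real) \<Rightarrow> real \<times> (real ^ 'n) \<Rightarrow> real" where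
  "h_smooth f F \<Gamma>1 \<Gamma>2 u = (\<Gamma>2 (snd u) - \<Gamma>1 (snd u)) * f (F (tilde_pt \<Gamma>1 \<Gamma>2 u))"

text \<open>
  \<open>F\<close> is only meaningful on \<open>unit_cube\<close>, so the formula for \<open>h_smooth\<close> is meaningful exactly at the
  points below. The only points of \<open>unit_cube\<close> left out are those with \<open>\<Gamma>1 = \<Gamma>2 = 0\<close> or
  \<open>\<Gamma>1 = \<Gamma>2 = 1\<close> at \<open>u\<^sub>2\<^sub>:\<^sub>d\<close>. There the factor \<open>\<Gamma>2 - \<Gamma>1\<close> makes \<open>h_smooth\<close> zero, whatever value
  \<open>F\<close> takes outside the cube, but \<open>h_smooth\<close> may be discontinuous: take \<open>\<Gamma>1 = 0\<close>,
  \<open>\<Gamma>2 v = \<bar>v $ i - 1/2\<bar>\<close> and \<open>f (F u) = 1 / (fst u)\<^sup>2\<close>.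
\<close>

definition smooth_dom ::
  "(real ^ 'n \<Rightarrow> real) \<Rightarrow> (real ^ 'n \<Rightarrow> real) \<Rightarrow> (real \<times> (real ^ 'n)) set" where
  "smooth_dom \<Gamma>1 \<Gamma>2 = {u \<in> unit_cube. tilde_pt \<Gamma>1 \<Gamma>2 u \<in> unit_cube}"

end

theory Submission imports Defs begin

text \<open>
  For fixed \<open>u\<^sub>2\<^sub>:\<^sub>d\<close> the affine map \<open>u\<^sub>1 \<mapsto> \<Gamma>1 + (\<Gamma>2 - \<Gamma>1) u\<^sub>1\<close> carries \<open>(\<Gamma>2 - \<Gamma>1) du\<^sub>1\<close> on
  \<open>(0,1)\<close> to \<open>du\<^sub>1\<close> on \<open>(\<Gamma>1, \<Gamma>2)\<close>. This gives unbiasedness, and applied to the square of the integrand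
  it gives \<open>E[h_smooth\<^sup>2] \<le> c E[(\<Gamma>2 - \<Gamma>1) (f \<circ> F)\<^sup>2 \<circ> tilde_pt] = c E[h_disc\<^sup>2]\<close>. Since \<open>c \<le> 1\<close>,
  subtracting the square of the common mean \<open>\<mu>\<close> yields
  \<open>Var h_smooth \<le> c E[h_disc\<^sup>2] - \<mu>\<^sup>2 \<le> c Var h_disc\<close>.
\<close>

section \<open>Change of variables along the first coordinate\<close>

lemma nn_integral_rescale_interval:
  fixes a b :: real and G :: "real \<Rightarrow> ennreal"
  assumes [measurable]: "G \<in> borel_measurable borel" and "a \<le> b"
  shows "(\<integral>\<^sup>+x. ennreal (b - a) * G (a + (b - a) * x) * indicator {0<..<1} x \<partial>lborel) =
         (\<integral>\<^sup>+x. G x * indicator {a<..<b} x \<partial>lborel)"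
\<comment> \<open>The affine map is invertible only for \<open>a < b\<close>. When
  \<open>a = b\<close> both sides vanish: the factor \<open>b - a\<close> is zero and the interval
  is empty.\<close>
proof (cases "a = b")
  case False
  with \<open>a \<le> b\<close> have ab: "b - a > 0" by simp
  have ind: "indicator {a<..<b} (a + (b - a) * x) = (indicator {0<..<1} x :: ennreal)" for x
  proof -
    have "a + (b - a) * x < b \<longleftrightarrow> (b - a) * x < (b - a) * 1" by auto
    also have "\<dots> \<longleftrightarrow> x < 1" using ab by (simp only: mult_less_cancel_left_pos)
    finally show ?thesis using ab by (auto simp: indicator_def zero_less_mult_iff)
  qed
  have "(\<integral>\<^sup>+x. G x * indicator {a<..<b} x \<partial>lborel) =
        ennreal \<bar>b - a\<bar> * (\<integral>\<^sup>+x. G (a + (b - a) * x) * indicator {a<..<b} (a + (b - a) * x) \<partial>lborel)"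
    using ab by (intro nn_integral_real_affine) auto
  also have "\<dots> = (\<integral>\<^sup>+x. ennreal (b - a) * G (a + (b - a) * x) * indicator {0<..<1} x \<partial>lborel)"
    unfolding ind using ab by (subst nn_integral_cmult[symmetric]) (auto simp: mult.assoc)
  finally show ?thesis ..
qed auto

text \<open>The boundaries are Borel functions ordered on the whole space, not only on
  \<open>V\<close>, and no continuity is asked of them. Extensions by zero of \<Gamma>1 and
  \<Gamma>2 can therefore be put in their place.\<close>

context
  fixes a b :: "'b::euclidean_space \<Rightarrow> real" and V :: "'b set"
  assumes a_meas [measurable]: "a \<in> borel_measurable borel"
    and b_meas [measurable]: "b \<in> borel_measurable borel"
    and V_meas [measurable]: "V \<in> sets borel"
    and ab_bounds: "\<And>v. 0 \<le> a v \<and> a v \<le> b v \<and> b v \<le> 1"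
begin

private abbreviation "M \<equiv> uniform_measure lborel ({0<..<1::real} \<times> V)"
private abbreviation "w \<equiv> (\<lambda>u::real \<times> 'b. b (snd u) - a (snd u))"
private abbreviation "T \<equiv> (\<lambda>u::real \<times> 'b. (a (snd u) + w u * fst u, snd u))"
private abbreviation "S \<equiv> {u::real \<times> 'b. a (snd u) < fst u \<and> fst u < b (snd u)}"

lemma strip_measurable [measurable]: "S \<in> sets borel"
proof -
  have "{u \<in> space borel. a (snd u) < fst u \<and> fst u < b (snd u)} \<in> sets (borel :: (real \<times> 'b) measure)"
    unfolding borel_prod[symmetric] by measurable
  then show ?thesis by simp
qed

lemma cylinder_measurable [measurable]: "{0<..<1::real} \<times> V \<in> sets borel"
  unfolding borel_prod[symmetric] by measurable

lemma strip_width_measurable [measurable]: "w \<in> borel_measurable borel"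
  unfolding borel_prod[symmetric] by measurable

lemma strip_map_measurable [measurable]: "T \<in> borel_measurable borel"
  unfolding borel_prod[symmetric] by measurable

text \<open>By Tonelli it suffices to compare the slices at fixed \<open>v\<close>, where the
  one-dimensional rescaling applies to the slice of \<open>A\<close>. An identity between measures
  transfers integrability and integrals of signed functions at once.\<close>

lemma distr_rescale_strip:
  "distr (density M (\<lambda>u. ennreal (w u))) lborel T = density M (\<lambda>u. ennreal (indicator S u))"
  (is "?L = ?R")
proof (rule measure_eqI)
  fix A assume "A \<in> sets ?L"
  then have A [measurable]: "A \<in> sets borel" by simp
  have A': "A \<in> sets (borel \<Otimes>\<^sub>M borel)" using A unfolding borel_prod .
  have sl [measurable]: "(\<lambda>x. (x, v)) -` A \<in> sets borel" for v
    using measurable_sets[OF measurable_Pair2'[of v borel borel] A'] by simp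
  let ?C = "{0<..<1::real} \<times> V"
  have "(\<integral>\<^sup>+u. ennreal (w u) * indicator A (T u) * indicator ?C u \<partial>lborel) =
        (\<integral>\<^sup>+v. \<integral>\<^sup>+x. ennreal (w (x, v)) * indicator A (T (x, v)) * indicator ?C (x, v) \<partial>lborel \<partial>lborel)"
    unfolding lborel_prod[symmetric]
    by (rule lborel_pair.nn_integral_snd[symmetric]) (simp add: lborel_prod)
  also have "\<dots> = (\<integral>\<^sup>+v. \<integral>\<^sup>+x. ennreal (indicator S (x, v)) * indicator A (x, v) * indicator ?C (x, v) \<partial>lborel \<partial>lborel)"
  proof (rule nn_integral_cong)
    fix v :: 'b
    show "(\<integral>\<^sup>+x. ennreal (w (x, v)) * indicator A (T (x, v)) * indicator ?C (x, v) \<partial>lborel) =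
          (\<integral>\<^sup>+x. ennreal (indicator S (x, v)) * indicator A (x, v) * indicator ?C (x, v) \<partial>lborel)"
    proof (cases "v \<in> V")
      case True
      let ?G = "indicator ((\<lambda>x. (x, v)) -` A) :: real \<Rightarrow> ennreal"
      have "(\<integral>\<^sup>+x. ennreal (w (x, v)) * indicator A (T (x, v)) * indicator ?C (x, v) \<partial>lborel) =
            (\<integral>\<^sup>+x. ennreal (b v - a v) * ?G (a v + (b v - a v) * x) * indicator {0<..<1} x \<partial>lborel)"
        using True by (intro nn_integral_cong) (auto simp: indicator_def)
      also have "\<dots> = (\<integral>\<^sup>+x. ?G x * indicator {a v<..<b v} x \<partial>lborel)"
        using ab_bounds[of v] by (intro nn_integral_rescale_interval) auto
      \<comment> \<open>As \<open>0 \<le> a v\<close> and \<open>b v \<le> 1\<close>, the interval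
        from \<open>a v\<close> to \<open>b v\<close> lies in the unit interval, so for
        \<open>v\<close> in \<open>V\<close> the indicator of the cylinder changes nothing.\<close>
      also have "\<dots> = (\<integral>\<^sup>+x. ennreal (indicator S (x, v)) * indicator A (x, v) * indicator ?C (x, v) \<partial>lborel)"
        using True ab_bounds[of v] by (intro nn_integral_cong) (auto simp: indicator_def)
      finally show ?thesis .
    qed simp
  qed
  also have "\<dots> = (\<integral>\<^sup>+u. ennreal (indicator S u) * indicator A u * indicator ?C u \<partial>lborel)"
    unfolding lborel_prod[symmetric]
    by (rule lborel_pair.nn_integral_snd) (simp add: lborel_prod)
  finally have eq: "(\<integral>\<^sup>+u. ennreal (w u) * indicator A (T u) * indicator ?C u \<partial>lborel) =
    (\<integral>\<^sup>+u. ennreal (indicator S u) * indicator A u * indicator ?C u \<partial>lborel)" .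
  have pre: "T -` A \<in> sets borel"
    using measurable_sets[OF strip_map_measurable A] by simp
  have "emeasure ?L A = (\<integral>\<^sup>+u. ennreal (w u) * indicator A (T u) \<partial>M)"
    using pre by (simp add: emeasure_distr emeasure_density indicator_vimage)
  \<comment> \<open>Both integrals over \<open>M\<close> are Lebesgue integrals over the cylinder
    divided by the same normalising constant.\<close>
  also have "\<dots> = (\<integral>\<^sup>+u. ennreal (indicator S u) * indicator A u \<partial>M)"
    by (simp add: nn_integral_uniform_measure eq)
  also have "\<dots> = emeasure ?R A"
    by (simp add: emeasure_density)
  finally show "emeasure ?L A = emeasure ?R A" .
qed simp

text \<open>Each side integrates \<open>g\<close> against one of two descriptions of the same
  measure. The equation of integrals is therefore unconditional: if integrability fails, it fails on
  both sides and both Bochner integrals are 0.\<close>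

lemma
  fixes g :: "real \<times> 'b \<Rightarrow> real"
  assumes [measurable]: "g \<in> borel_measurable borel"
  shows integrable_rescale_strip:
      "integrable M (\<lambda>u. w u * g (T u)) \<longleftrightarrow> integrable M (\<lambda>u. g u * indicator S u)"
    and integral_rescale_strip:
      "(\<integral>u. w u * g (T u) \<partial>M) = (\<integral>u. g u * indicator S u \<partial>M)"
proof -
  have w0: "AE u in M. 0 \<le> w u" using ab_bounds by simp
  have "integrable M (\<lambda>u. w u * g (T u)) \<longleftrightarrow> integrable (distr (density M (\<lambda>u. ennreal (w u))) lborel T) g"
    using w0 by (simp add: integrable_distr_eq integrable_density)
  also have "\<dots> \<longleftrightarrow> integrable M (\<lambda>u. g u * indicator S u)"
    unfolding distr_rescale_strip by (simp add: integrable_density mult.commute)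
  finally show "integrable M (\<lambda>u. w u * g (T u)) \<longleftrightarrow> integrable M (\<lambda>u. g u * indicator S u)" .
  have "(\<integral>u. w u * g (T u) \<partial>M) = (\<integral>u. g u \<partial>distr (density M (\<lambda>u. ennreal (w u))) lborel T)"
    using w0 by (simp add: integral_distr integral_density)
  also have "\<dots> = (\<integral>u. g u * indicator S u \<partial>M)"
    unfolding distr_rescale_strip by (simp add: integral_density mult.commute)
  finally show "(\<integral>u. w u * g (T u) \<partial>M) = (\<integral>u. g u * indicator S u \<partial>M)" .
qed

end

section \<open>Topology of the cubes and continuity of the smoothed integrand\<close>

lemma open_open_cube: "open (open_cube :: (real ^ 'n) set)"
proof -
  have "open_cube = (\<Inter>i. {v :: real ^ 'n. 0 < v $ i \<and> v $ i < 1})"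
    by (auto simp: open_cube_def)
  also have "open \<dots>"
    by (intro open_INT ballI open_Collect_conj open_Collect_less continuous_intros) auto
  finally show ?thesis .
qed

lemma open_unit_cube: "open (unit_cube :: (real \<times> (real ^ 'n)) set)"
  unfolding unit_cube_def by (intro open_Times open_open_cube) auto

text \<open>A real supremum inherits an upper bound of its family only when the index set is
  nonempty; this serves to show \<open>c \<le> 1\<close>.\<close>

lemma open_cube_nonempty: "(open_cube :: (real ^ 'n) set) \<noteq> {}"
proof -
  have "(\<chi> i. 1/2) \<in> (open_cube :: (real ^ 'n) set)" by (simp add: open_cube_def)
  then show ?thesis by blast
qed

text \<open>On \<open>smooth_dom\<close> the transformed point stays in \<open>unit_cube\<close>,
  where \<open>F\<close> is continuous; the rest is composition of continuous maps.\<close>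

lemma continuous_on_h_smooth:
  fixes F :: "real \<times> (real ^ 'n) \<Rightarrow> real ^ 'm"
  assumes "continuous_on open_cube \<Gamma>1" "continuous_on open_cube \<Gamma>2"
    and "continuous_on unit_cube F" "continuous_on UNIV f"
  shows "continuous_on (smooth_dom \<Gamma>1 \<Gamma>2) (h_smooth f F \<Gamma>1 \<Gamma>2)"
proof -
  have sub: "snd ` smooth_dom \<Gamma>1 \<Gamma>2 \<subseteq> open_cube"
    by (auto simp: smooth_dom_def unit_cube_def)
  have c1: "continuous_on (smooth_dom \<Gamma>1 \<Gamma>2) (\<lambda>u. \<Gamma>1 (snd u))"
    by (rule continuous_on_compose2[OF assms(1) _ sub]) (intro continuous_intros)
  have c2: "continuous_on (smooth_dom \<Gamma>1 \<Gamma>2) (\<lambda>u. \<Gamma>2 (snd u))"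
    by (rule continuous_on_compose2[OF assms(2) _ sub]) (intro continuous_intros)
  have "continuous_on (smooth_dom \<Gamma>1 \<Gamma>2) (tilde_pt \<Gamma>1 \<Gamma>2)"
    unfolding tilde_pt_def by (intro continuous_intros c1 c2)
  then have cF: "continuous_on (smooth_dom \<Gamma>1 \<Gamma>2) (\<lambda>u. F (tilde_pt \<Gamma>1 \<Gamma>2 u))"
    by (rule continuous_on_compose2[OF assms(3)]) (auto simp: smooth_dom_def)
  have "continuous_on (smooth_dom \<Gamma>1 \<Gamma>2) (\<lambda>u. f (F (tilde_pt \<Gamma>1 \<Gamma>2 u)))"
    by (rule continuous_on_compose2[OF assms(4) cF]) simp
  then show ?thesis
    unfolding h_smooth_def by (intro continuous_intros c1 c2)
qed

section \<open>Unbiasedness and variance reduction\<close>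

text \<open>The expectation of a non-integrable function is 0 by default, so the equality of
  expectations is accompanied by an equivalence of integrability. For the same reason the variance
  bound is stated under square integrability of \<open>h_disc\<close>.\<close>

theorem theorem1:
  fixes F :: "real \<times> (real ^ 'n) \<Rightarrow> real ^ 'm"
    and f :: "real ^ 'm \<Rightarrow> real"
    and \<Gamma>1 \<Gamma>2 :: "real ^ 'n \<Rightarrow> real"
    and P :: "'w measure"
    and U :: "'w \<Rightarrow> real \<times> (real ^ 'n)"
  assumes \<Gamma>_bounds: "\<And>v. v \<in> open_cube \<Longrightarrow> 0 \<le> \<Gamma>1 v \<and> \<Gamma>1 v \<le> \<Gamma>2 v \<and> \<Gamma>2 v \<le> 1"
    and \<Gamma>1_cont: "continuous_on open_cube \<Gamma>1"
    and \<Gamma>2_cont: "continuous_on open_cube \<Gamma>2"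
    and F_cont: "\<And>i. continuous_on unit_cube (\<lambda>u. F u $ i)"
    and f_cont: "continuous_on UNIV f"
    and P: "prob_space P"
    and U_meas: "U \<in> P \<rightarrow>\<^sub>M lborel"
    and U_cube: "\<And>\<omega>. \<omega> \<in> space P \<Longrightarrow> U \<omega> \<in> unit_cube"
    and U_unif: "distr P lborel U = uniform_measure lborel unit_cube"
  shows
    "continuous_on (smooth_dom \<Gamma>1 \<Gamma>2) (h_smooth f F \<Gamma>1 \<Gamma>2)
     \<and> ((integrable P (\<lambda>\<omega>. h_smooth f F \<Gamma>1 \<Gamma>2 (U \<omega>)) \<longleftrightarrow>
           integrable P (\<lambda>\<omega>. h_disc f F \<Gamma>1 \<Gamma>2 (U \<omega>)))
        \<and> prob_space.expectation P (\<lambda>\<omega>. h_smooth f F \<Gamma>1 \<Gamma>2 (U \<omega>)) =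
          prob_space.expectation P (\<lambda>\<omega>. h_disc f F \<Gamma>1 \<Gamma>2 (U \<omega>)))
     \<and> (integrable P (\<lambda>\<omega>. (h_disc f F \<Gamma>1 \<Gamma>2 (U \<omega>))\<^sup>2) \<longrightarrow>
          integrable P (\<lambda>\<omega>. (h_smooth f F \<Gamma>1 \<Gamma>2 (U \<omega>))\<^sup>2)
          \<and> prob_space.variance P (\<lambda>\<omega>. h_smooth f F \<Gamma>1 \<Gamma>2 (U \<omega>))
            \<le> (SUP v\<in>open_cube. \<Gamma>2 v - \<Gamma>1 v)
               * prob_space.variance P (\<lambda>\<omega>. h_disc f F \<Gamma>1 \<Gamma>2 (U \<omega>)))"
proof -
  interpret prob_space P by (rule P)
  have F_cont': "continuous_on unit_cube F"
    using F_cont continuous_on_vec_lambda[of unit_cube "\<lambda>i u. F u $ i"] by simp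
  text \<open>
    Extension by zero makes \<open>\<Gamma>1\<close>, \<open>\<Gamma>2\<close> and \<open>f \<circ> F\<close>, which are only controlled on the cubes,
    Borel measurable everywhere.
  \<close>
  define a where "a v = (if v \<in> open_cube then \<Gamma>1 v else 0)" for v
  define b where "b v = (if v \<in> open_cube then \<Gamma>2 v else 0)" for v
  define g where "g u = (if u \<in> unit_cube then f (F u) else 0)" for u
  define w where "w u = b (snd u) - a (snd u)" for u :: "real \<times> (real ^ 'n)"
  define T where "T u = (a (snd u) + w u * fst u, snd u)" for u :: "real \<times> (real ^ 'n)"
  define S where "S = {u :: real \<times> (real ^ 'n). a (snd u) < fst u \<and> fst u < b (snd u)}"
  define c where "c = (SUP v\<in>open_cube. \<Gamma>2 v - \<Gamma>1 v)"
  let ?M = "uniform_measure lborel (unit_cube :: (real \<times> (real ^ 'n)) set)"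
  let ?h = "h_disc f F \<Gamma>1 \<Gamma>2" and ?k = "h_smooth f F \<Gamma>1 \<Gamma>2"
  have a_meas [measurable]: "a \<in> borel_measurable borel"
    unfolding a_def using \<Gamma>1_cont open_open_cube
    by (intro borel_measurable_continuous_on_if borel_open) auto
  have b_meas [measurable]: "b \<in> borel_measurable borel"
    unfolding b_def using \<Gamma>2_cont open_open_cube
    by (intro borel_measurable_continuous_on_if borel_open) auto
  have g_meas [measurable]: "g \<in> borel_measurable borel"
    unfolding g_def using open_unit_cube continuous_on_compose2[OF f_cont F_cont']
    by (intro borel_measurable_continuous_on_if borel_open) auto
  have ab: "0 \<le> a v \<and> a v \<le> b v \<and> b v \<le> 1" for v
    using \<Gamma>_bounds[of v] by (simp add: a_def b_def)
  have V_meas: "(open_cube :: (real ^ 'n) set) \<in> sets borel"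
    by (rule borel_open[OF open_open_cube])
  note strip = a_meas b_meas V_meas ab
  have [measurable]: "w \<in> borel_measurable borel" "T \<in> borel_measurable borel" "S \<in> sets borel"
    unfolding w_def T_def S_def
    by (rule strip_width_measurable[OF strip] strip_map_measurable[OF strip]
        strip_measurable[OF strip])+
  \<comment> \<open>\<open>G\<close> stays general because two instances follow: \<open>g\<close>
    for the means and \<open>g\<^sup>2\<close> for the second moments.\<close>
  have rescale: "integrable ?M (\<lambda>u. w u * G (T u)) \<longleftrightarrow> integrable ?M (\<lambda>u. G u * indicator S u)"
    "(\<integral>u. w u * G (T u) \<partial>?M) = (\<integral>u. G u * indicator S u \<partial>?M)"
    if "G \<in> borel_measurable borel" for G
    using integrable_rescale_strip[OF strip that] integral_rescale_strip[OF strip that]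
    unfolding w_def T_def S_def unit_cube_def by auto
  have h_eq: "?h (U \<omega>) = g (U \<omega>) * indicator S (U \<omega>)" if "\<omega> \<in> space P" for \<omega>
    using U_cube[OF that]
    by (auto simp: h_disc_def g_def S_def a_def b_def unit_cube_def indicator_def)
  \<comment> \<open>The transformed point may leave the open cube, where \<open>g\<close> is 0 but
    \<open>f (F u)\<close> is arbitrary. This happens only if \<Gamma>1 and \<Gamma>2 agree at
    \<open>v\<close>, and then the factor \<open>w\<close> annihilates both sides; otherwise the
    point lies strictly between them.\<close>
  have k_eq: "?k (U \<omega>) = w (U \<omega>) * g (T (U \<omega>))" if "\<omega> \<in> space P" for \<omega>
  proof -
    obtain x v where u: "U \<omega> = (x, v)" by fastforce
    have x: "0 < x" "x < 1" and v: "v \<in> open_cube"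
      using U_cube[OF that] by (auto simp: u unit_cube_def)
    have Teq: "tilde_pt \<Gamma>1 \<Gamma>2 (x, v) = T (x, v)" "w (x, v) = \<Gamma>2 v - \<Gamma>1 v"
      using v by (auto simp: tilde_pt_def T_def w_def a_def b_def)
    show ?thesis
    proof (cases "\<Gamma>1 v = \<Gamma>2 v")
      case False
      with \<Gamma>_bounds[OF v] have d: "0 < \<Gamma>2 v - \<Gamma>1 v" by auto
      have "0 < (\<Gamma>2 v - \<Gamma>1 v) * x" "(\<Gamma>2 v - \<Gamma>1 v) * x < \<Gamma>2 v - \<Gamma>1 v"
        using d x by simp_all
      then have "tilde_pt \<Gamma>1 \<Gamma>2 (x, v) \<in> unit_cube"
        using v \<Gamma>_bounds[OF v] by (auto simp: tilde_pt_def unit_cube_def)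
      then show ?thesis by (simp add: u h_smooth_def g_def Teq)
    qed (simp add: u h_smooth_def Teq)
  qed
  have trans: "integrable P (\<lambda>\<omega>. G (U \<omega>)) \<longleftrightarrow> integrable ?M G"
    "(\<integral>\<omega>. G (U \<omega>) \<partial>P) = (\<integral>u. G u \<partial>?M)"
    if "G \<in> borel_measurable borel" for G :: "real \<times> (real ^ 'n) \<Rightarrow> real"
    using that unfolding U_unif[symmetric]
    by (simp_all add: integrable_distr_eq[OF U_meas] integral_distr[OF U_meas])
  \<comment> \<open>The square of \<open>h_smooth\<close> carries the factor \<open>w\<close> twice.
    One copy is kept here, as the density for the change of variables applied to
    \<open>g\<^sup>2\<close>; the other will be bounded by \<open>c\<close>.\<close>
  define wgg where "wgg u = w u * (g (T u))\<^sup>2" for u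
  have [measurable]: "wgg \<in> borel_measurable borel" unfolding wgg_def by measurable
  have int_cong: "integrable P (\<lambda>\<omega>. ?k (U \<omega>)) \<longleftrightarrow> integrable ?M (\<lambda>u. w u * g (T u))"
    "integrable P (\<lambda>\<omega>. ?h (U \<omega>)) \<longleftrightarrow> integrable ?M (\<lambda>u. g u * indicator S u)"
    "expectation (\<lambda>\<omega>. ?k (U \<omega>)) = (\<integral>u. w u * g (T u) \<partial>?M)"
    "expectation (\<lambda>\<omega>. ?h (U \<omega>)) = (\<integral>u. g u * indicator S u \<partial>?M)"
    by (simp_all add: h_eq k_eq trans[symmetric] cong: Bochner_Integration.integrable_cong
        Bochner_Integration.integral_cong)
  have unbiased: "integrable P (\<lambda>\<omega>. ?k (U \<omega>)) \<longleftrightarrow> integrable P (\<lambda>\<omega>. ?h (U \<omega>))"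
    "expectation (\<lambda>\<omega>. ?k (U \<omega>)) = expectation (\<lambda>\<omega>. ?h (U \<omega>))"
    unfolding int_cong by (rule rescale[OF g_meas])+
  \<comment> \<open>An indicator equals its own square, so the squared integrand again has the form
    to which \<open>rescale\<close> applies.\<close>
  have h2_eq: "(?h (U \<omega>))\<^sup>2 = (g (U \<omega>))\<^sup>2 * indicator S (U \<omega>)" if "\<omega> \<in> space P" for \<omega>
    using h_eq[OF that] by (simp add: indicator_def)
  have bdd: "bdd_above ((\<lambda>v. \<Gamma>2 v - \<Gamma>1 v) ` open_cube)"
    using \<Gamma>_bounds by (intro bdd_aboveI[of _ 1]) force
  have w_le: "w (U \<omega>) \<le> c" if "\<omega> \<in> space P" for \<omega>
    using U_cube[OF that] unfolding c_def
    by (intro cSUP_upper2[OF bdd, of "snd (U \<omega>)"]) (auto simp: w_def a_def b_def unit_cube_def)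
  have w_ge: "0 \<le> w u" for u
    using ab by (simp add: w_def)
  have c_le: "c \<le> 1"
    unfolding c_def using \<Gamma>_bounds open_cube_nonempty
    by (intro cSUP_least) force+
  have variance: "integrable P (\<lambda>\<omega>. (?k (U \<omega>))\<^sup>2) \<and>
      variance (\<lambda>\<omega>. ?k (U \<omega>)) \<le> c * variance (\<lambda>\<omega>. ?h (U \<omega>))"
    if h2: "integrable P (\<lambda>\<omega>. (?h (U \<omega>))\<^sup>2)"
  proof -
    have [measurable]: "U \<in> borel_measurable P" using U_meas by simp
    have h_m: "(\<lambda>\<omega>. ?h (U \<omega>)) \<in> borel_measurable P"
      by (subst measurable_cong[OF h_eq]) (assumption, measurable)
    have k_m: "(\<lambda>\<omega>. ?k (U \<omega>)) \<in> borel_measurable P"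
      by (subst measurable_cong[OF k_eq]) (assumption, measurable)
    have h1: "integrable P (\<lambda>\<omega>. ?h (U \<omega>))"
      using square_integrable_imp_integrable[OF h_m h2] .
    then have k1: "integrable P (\<lambda>\<omega>. ?k (U \<omega>))"
      using unbiased by simp
    have wgg_int: "integrable P (\<lambda>\<omega>. wgg (U \<omega>))"
      and wgg_E: "expectation (\<lambda>\<omega>. wgg (U \<omega>)) = expectation (\<lambda>\<omega>. (?h (U \<omega>))\<^sup>2)"
    proof -
      have "integrable P (\<lambda>\<omega>. (?h (U \<omega>))\<^sup>2) \<longleftrightarrow> integrable ?M (\<lambda>u. (g u)\<^sup>2 * indicator S u)"
        "expectation (\<lambda>\<omega>. (?h (U \<omega>))\<^sup>2) = (\<integral>u. (g u)\<^sup>2 * indicator S u \<partial>?M)"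
        by (simp_all add: h2_eq trans[symmetric] cong: Bochner_Integration.integrable_cong
            Bochner_Integration.integral_cong)
      then show "integrable P (\<lambda>\<omega>. wgg (U \<omega>))"
        "expectation (\<lambda>\<omega>. wgg (U \<omega>)) = expectation (\<lambda>\<omega>. (?h (U \<omega>))\<^sup>2)"
        using h2 rescale[of "\<lambda>u. (g u)\<^sup>2", folded wgg_def] by (simp_all add: trans)
    qed
    have le: "(?k (U \<omega>))\<^sup>2 \<le> c * wgg (U \<omega>)" if "\<omega> \<in> space P" for \<omega>
    proof -
      have "(?k (U \<omega>))\<^sup>2 = w (U \<omega>) * wgg (U \<omega>)"
        by (simp add: k_eq[OF that] wgg_def power2_eq_square)
      also have "\<dots> \<le> c * wgg (U \<omega>)"
        using w_le[OF that] w_ge by (intro mult_right_mono) (auto simp: wgg_def)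
      finally show ?thesis .
    qed
    have k2: "integrable P (\<lambda>\<omega>. (?k (U \<omega>))\<^sup>2)"
    proof (rule Bochner_Integration.integrable_bound)
      show "integrable P (\<lambda>\<omega>. c * wgg (U \<omega>))" using wgg_int by simp
      show "AE \<omega> in P. norm ((?k (U \<omega>))\<^sup>2) \<le> norm (c * wgg (U \<omega>))"
        using le by (intro AE_I2) force
    qed (use k_m in simp)
    have "expectation (\<lambda>\<omega>. (?k (U \<omega>))\<^sup>2) \<le> expectation (\<lambda>\<omega>. c * wgg (U \<omega>))"
      using le wgg_int k2 by (intro integral_mono) auto
    also have "\<dots> = c * expectation (\<lambda>\<omega>. (?h (U \<omega>))\<^sup>2)"
      using wgg_E by simp
    finally have E2: "expectation (\<lambda>\<omega>. (?k (U \<omega>))\<^sup>2) \<le> c * expectation (\<lambda>\<omega>. (?h (U \<omega>))\<^sup>2)" .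
    let ?\<mu> = "expectation (\<lambda>\<omega>. ?h (U \<omega>))"
    \<comment> \<open>The right-hand variance is scaled by \<open>c\<close> as a whole, its mean
      term included, so the two mean terms have to be compared as well.\<close>
    have "c * ?\<mu>\<^sup>2 \<le> ?\<mu>\<^sup>2"
      using mult_right_mono[OF c_le, of "?\<mu>\<^sup>2"] by simp
    with E2 have "variance (\<lambda>\<omega>. ?k (U \<omega>)) \<le> c * variance (\<lambda>\<omega>. ?h (U \<omega>))"
      unfolding variance_eq[OF k1 k2] variance_eq[OF h1 h2]
      unfolding unbiased(2) by (simp add: right_diff_distrib)
    with k2 show ?thesis by simp
  qed
  show ?thesis
    using continuous_on_h_smooth[OF \<Gamma>1_cont \<Gamma>2_cont F_cont' f_cont] unbiased variance
    unfolding c_def by blast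
qed

end
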